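(* Let $n\ge 21$ and let $m$ be such that $n\in\Gamma_{1,m,1}$. Then $m\ge 5$. Put $$\theta_m^7=\tfrac{t_m+2t_{m-1}-t_{m-2}-1}{2},\quad \theta_m^8=\tfrac{t_m+3t_{m-2}-1}{2},\quad \theta_m^9=\tfrac{-t_m+4t_{m-1}+3t_{m-2}-1}{2},$$ $$\eta_m^3=2t_{m-1},\quad \theta_m^{10}=\tfrac{t_m+2t_{m-1}+t_{m-2}-1}{2}.$$ Then $\sum_{i=\min\Gamma_{1,m,1}}^{n}a(i)$ is equal to: (i) $\sum_{i=\min\Gamma_{3,m-1,1}}^{n-t_{m-1}}a(i)$ if $\theta_m^7\le n<\theta_m^8$; (ii) $\sum_{i=\min\Gamma_{2,m-1,1}}^{n-t_{m-1}}a(i)+\sum a(\Gamma_{3,m-1,1})$ if $\theta_m^8\le n<\theta_m^9$; (iii) $\sum_{i=\min\Gamma_{1,m-1,1}}^{n-t_{m-1}}a(i)+\sum a(\Gamma_{3,m-1,1})+\sum a(\Gamma_{2,m-1,1})$ if $\theta_m^9\le n<\eta_m^3$; (iv) $\sum_{i=\min\Gamma_{1,m-1,1}}^{n-t_{m-1}}a(i)+\sum a(\Gamma_{3,m-1,1})+\sum a(\Gamma_{2,m-1,1})+n-\eta_m^3+1$ otherwise (that is, if $\eta_m^3\le n<\theta_m^{10}$).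
   Context: The Tribonacci sequence $\mathbb{T}$ is the fixed point beginning with $a$ of the substitution $\sigma(a)=ab,\ \sigma(b)=ac,\ \sigma(c)=a$; positions are numbered from $1$. For a nonempty factor $\omega$ of $\mathbb{T}$, $\omega_p$ denotes its $p$-th occurrence. The word $\omega_p\omega_{p+1}$ is a (repeated) square if $\omega_{p+1}$ begins immediately after $\omega_p$ ends. For $n\ge 1$, $a(n)$ is the number of pairs $(\omega,p)$ such that $\omega_p\omega_{p+1}$ is a square ending exactly at position $n$. The Tribonacci numbers are $t_m=|\sigma^m(a)|$ for $m\ge 0$ ($t_0=1,t_1=2,t_2=4,t_3=7$, $t_m=t_{m-1}+t_{m-2}+t_{m-3}$). For $m\ge 4$ define the sets of consecutive integers $$\Gamma_{1,m,1}=\left\{\tfrac{t_m+2t_{m-1}-t_{m-2}-1}{2},\dots,\tfrac{t_m+2t_{m-1}+t_{m-2}-3}{2}\right\},$$ $$\Gamma_{2,m,1}=\left\{\tfrac{-t_m+4t_{m-1}+t_{m-2}-1}{2},\dots,\tfrac{t_m+2t_{m-1}-t_{m-2}-3}{2}\right\},$$ $$\Gamma_{3,m,1}=\left\{\tfrac{t_m+t_{m-2}-1}{2},\dots,\tfrac{-t_m+4t_{m-1}+t_{m-2}-3}{2}\right\}.$$ Write $\sum a(\Gamma)=\sum_{i\in\Gamma}a(i)$. *)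

theory Defs
  imports Complex_Main "HOL-Library.Infinite_Set"
begin

datatype letter = La | Lb | Lc

fun sigma_letter :: "letter \<Rightarrow> letter list" where
  "sigma_letter La = [La, Lb]"
| "sigma_letter Lb = [La, Lc]"
| "sigma_letter Lc = [La]"

definition sigma :: "letter list \<Rightarrow> letter list" where
  "sigma w = concat (map sigma_letter w)"

definition sigma_pow :: "nat \<Rightarrow> letter list" where
  "sigma_pow m = (sigma ^^ m) [La]"

text \<open>Positions are numbered from 1; the value at 0 carries no meaning. The word
  \<open>sigma_pow i\<close> has more than \<open>i\<close> letters and is a prefix of all later iterates.
  Lemmas \<open>tribonacci_fixed_point\<close> and \<open>tribonacci_unique\<close> show that this is the
  fixed point of \<open>sigma\<close> starting with \<open>La\<close>.\<close>
definition tribonacci :: "nat \<Rightarrow> letter" where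
  "tribonacci i = sigma_pow i ! (i - 1)"

definition prefix_of :: "(nat \<Rightarrow> letter) \<Rightarrow> nat \<Rightarrow> letter list" where
  "prefix_of w n = map w [1..<Suc n]"

text \<open>An infinite word is fixed by \<open>sigma\<close> if the images of its prefixes are again its prefixes.\<close>
definition is_fixed_point :: "(nat \<Rightarrow> letter) \<Rightarrow> bool" where
  "is_fixed_point w \<longleftrightarrow>
     (\<forall>n. sigma (prefix_of w n) = prefix_of w (length (sigma (prefix_of w n))))"

definition t :: "nat \<Rightarrow> nat" where
  "t m = length (sigma_pow m)"

definition occurs_at :: "letter list \<Rightarrow> nat \<Rightarrow> bool" where
  "occurs_at w i \<longleftrightarrow> i \<ge> 1 \<and> (\<forall>j < length w. tribonacci (i + j) = w ! j)"

definition is_factor :: "letter list \<Rightarrow> bool" where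
  "is_factor w \<longleftrightarrow> (\<exists>i. occurs_at w i)"

text \<open>Starting position of the \<open>p\<close>-th occurrence, \<open>p \<ge> 1\<close>. The enumerated set is infinite
  for every factor, see \<open>infinite_occurrences\<close>.\<close>
definition occ_start :: "letter list \<Rightarrow> nat \<Rightarrow> nat" where
  "occ_start w p = enumerate {i. occurs_at w i} (p - 1)"

definition occ_end :: "letter list \<Rightarrow> nat \<Rightarrow> nat" where
  "occ_end w p = occ_start w p + length w - 1"

definition is_square :: "letter list \<Rightarrow> nat \<Rightarrow> bool" where
  "is_square w p \<longleftrightarrow> occ_start w (p + 1) = occ_end w p + 1"

definition a :: "nat \<Rightarrow> nat" where
  "a n = card {(w, p). w \<noteq> [] \<and> is_factor w \<and> p \<ge> 1 \<and> is_square w p \<and> occ_end w (p + 1) = n}"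

text \<open>All end points below are computed in the reals, so that neither subtraction nor halving
  truncates. They are positive integers for \<open>m \<ge> 4\<close>.\<close>

definition Gamma1 :: "nat \<Rightarrow> nat set" where
  "Gamma1 m = {i. (real (t m) + 2 * real (t (m-1)) - real (t (m-2)) - 1) / 2 \<le> real i \<and>
                  real i \<le> (real (t m) + 2 * real (t (m-1)) + real (t (m-2)) - 3) / 2}"

definition Gamma2 :: "nat \<Rightarrow> nat set" where
  "Gamma2 m = {i. (- real (t m) + 4 * real (t (m-1)) + real (t (m-2)) - 1) / 2 \<le> real i \<and>
                  real i \<le> (real (t m) + 2 * real (t (m-1)) - real (t (m-2)) - 3) / 2}"

definition Gamma3 :: "nat \<Rightarrow> nat set" where
  "Gamma3 m = {i. (real (t m) + real (t (m-2)) - 1) / 2 \<le> real i \<and>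
                  real i \<le> (- real (t m) + 4 * real (t (m-1)) + real (t (m-2)) - 3) / 2}"

definition theta7 :: "nat \<Rightarrow> real" where
  "theta7 m = (real (t m) + 2 * real (t (m-1)) - real (t (m-2)) - 1) / 2"

definition theta8 :: "nat \<Rightarrow> real" where
  "theta8 m = (real (t m) + 3 * real (t (m-2)) - 1) / 2"

definition theta9 :: "nat \<Rightarrow> real" where
  "theta9 m = (- real (t m) + 4 * real (t (m-1)) + 3 * real (t (m-2)) - 1) / 2"

definition theta10 :: "nat \<Rightarrow> real" where
  "theta10 m = (real (t m) + 2 * real (t (m-1)) + real (t (m-2)) - 1) / 2"

definition eta3 :: "nat \<Rightarrow> nat" where
  "eta3 m = 2 * t (m-1)"

lemma sigma_append: "sigma (u @ v) = sigma u @ sigma v"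
  by (simp add: sigma_def)

lemma sigma_funpow_append: "(sigma ^^ k) (u @ v) = (sigma ^^ k) u @ (sigma ^^ k) v"
  by (induction k) (simp_all add: sigma_append)

lemma length_sigma: "length w \<le> length (sigma w)"
proof (induction w)
  case (Cons x w)
  then show ?case by (cases x) (simp_all add: sigma_def)
qed simp

lemma length_sigma_funpow: "length w \<le> length ((sigma ^^ k) w)"
proof (induction k)
  case (Suc k)
  then show ?case using length_sigma[of "(sigma ^^ k) w"] by simp
qed simp

lemma sigma_pow_Suc: "sigma_pow (Suc k) = sigma_pow k @ (sigma ^^ k) [Lb]"
proof -
  have "sigma_pow (Suc k) = (sigma ^^ k) ([La] @ [Lb])"
    unfolding sigma_pow_def funpow_Suc_right by (simp add: sigma_def)
  then show ?thesis unfolding sigma_funpow_append sigma_pow_def .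
qed

lemma sigma_pow_le: "k \<le> l \<Longrightarrow> \<exists>v. sigma_pow l = sigma_pow k @ v"
proof (induction l rule: dec_induct)
  case (step l)
  then show ?case by (auto simp: sigma_pow_Suc)
qed simp

lemma t_gt: "m < t m"
proof (induction m)
  case (Suc m)
  then show ?case
    using length_sigma_funpow[of "[Lb]" m] by (simp add: t_def sigma_pow_Suc)
qed (simp add: t_def sigma_pow_def)

lemma sigma_pow_rec: "sigma_pow (m + 3) = sigma_pow (m + 2) @ sigma_pow (m + 1) @ sigma_pow m"
proof -
  have "sigma_pow (m + 3) = (sigma ^^ m) ((sigma ^^ 3) [La])"
    unfolding sigma_pow_def funpow_add comp_def ..
  also have "(sigma ^^ 3) [La] = (sigma ^^ 2) [La] @ sigma [La] @ [La]"
    by (simp add: numeral_eq_Suc sigma_def)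
  also have "(sigma ^^ m) \<dots> = sigma_pow (m + 2) @ sigma_pow (m + 1) @ sigma_pow m"
    unfolding sigma_funpow_append sigma_pow_def funpow_add comp_def by simp
  finally show ?thesis .
qed

lemma t_rec: "t (m + 3) = t (m + 2) + t (m + 1) + t m"
  by (simp add: t_def sigma_pow_rec)

lemma tribonacci_nth:
  assumes "j < t k"
  shows "tribonacci (Suc j) = sigma_pow k ! j"
proof -
  have j: "j < t (Suc j)" using t_gt[of "Suc j"] by simp
  show ?thesis
  proof (cases "k \<le> Suc j")
    case True
    then obtain v where "sigma_pow (Suc j) = sigma_pow k @ v" using sigma_pow_le by blast
    then show ?thesis using assms by (simp add: tribonacci_def t_def nth_append)
  next
    case False
    then obtain v where "sigma_pow k = sigma_pow (Suc j) @ v"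
      using sigma_pow_le[of "Suc j" k] by auto
    then show ?thesis using j by (simp add: tribonacci_def t_def nth_append)
  qed
qed

lemma length_prefix_of [simp]: "length (prefix_of w n) = n"
  by (simp add: prefix_of_def)

lemma nth_prefix_of [simp]: "j < n \<Longrightarrow> prefix_of w n ! j = w (Suc j)"
  by (simp add: prefix_of_def del: upt_Suc)

lemma prefix_of_tribonacci: "n \<le> t k \<Longrightarrow> prefix_of tribonacci n = take n (sigma_pow k)"
  by (rule nth_equalityI) (auto simp: tribonacci_nth t_def)

lemma tribonacci_fixed_point: "is_fixed_point tribonacci"
  unfolding is_fixed_point_def
proof
  fix n
  have p: "prefix_of tribonacci n = take n (sigma_pow n)"
    using t_gt[of n] by (intro prefix_of_tribonacci) simp
  have "sigma_pow (Suc n) = sigma (take n (sigma_pow n) @ drop n (sigma_pow n))"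
    by (simp add: sigma_pow_def)
  then have s: "sigma_pow (Suc n) = sigma (prefix_of tribonacci n) @ sigma (drop n (sigma_pow n))"
    by (simp only: sigma_append p)
  then have "length (sigma (prefix_of tribonacci n)) \<le> t (Suc n)"
    by (simp add: t_def)
  from prefix_of_tribonacci[OF this] show
    "sigma (prefix_of tribonacci n) = prefix_of tribonacci (length (sigma (prefix_of tribonacci n)))"
    by (simp add: s)
qed

lemma tribonacci_1: "tribonacci 1 = La"
  by (simp add: tribonacci_def sigma_pow_def sigma_def)

lemma tribonacci_unique:
  assumes "is_fixed_point w" "w 1 = La" "i \<ge> 1"
  shows "w i = tribonacci i"
proof -
  have *: "sigma_pow k = prefix_of w (t k)" for k
  proof (induction k)
    case 0
    then show ?case using assms(2) by (simp add: prefix_of_def t_def sigma_pow_def)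
  next
    case (Suc k)
    have "sigma_pow (Suc k) = sigma (prefix_of w (t k))"
      by (simp add: sigma_pow_def flip: Suc[unfolded sigma_pow_def])
    then show ?case using assms(1) unfolding is_fixed_point_def t_def by metis
  qed
  obtain j where j: "i = Suc j" using assms(3) by (cases i) auto
  have "j < t i" using t_gt[of i] j by simp
  then show ?thesis using tribonacci_nth[of j i] *[of i] j by simp
qed

lemma infinite_occurrences:
  assumes "is_factor w"
  shows "infinite {i. occurs_at w i}"
proof -
  obtain i where i: "occurs_at w i" using assms by (auto simp: is_factor_def)
  then have i1: "i \<ge> 1" by (simp add: occurs_at_def)
  define k where "k = i + length w"
  have k: "k < t k" by (rule t_gt)
  have wj: "w ! j = sigma_pow k ! (i - 1 + j)" if "j < length w" for j
    using tribonacci_nth[of "i - 1 + j" k] i i1 that k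
    by (auto simp: occurs_at_def k_def algebra_simps)
  show ?thesis unfolding infinite_nat_iff_unbounded
  proof
    fix N
    define l where "l = k + N"
    have "sigma_pow (l + 3) = sigma_pow (l + 2) @ sigma_pow (l + 1) @ sigma_pow l"
      by (rule sigma_pow_rec)
    moreover obtain v where "sigma_pow (l + 1) = sigma_pow k @ v"
      using sigma_pow_le[of k "l + 1"] by (auto simp: l_def)
    ultimately obtain u where s: "sigma_pow (l + 3) = sigma_pow (l + 2) @ sigma_pow k @ u"
      by auto
    have "occurs_at w (t (l + 2) + i)"
      unfolding occurs_at_def
    proof (intro conjI allI impI)
      fix j assume j: "j < length w"
      have lt: "i - 1 + j < t k" using j i1 k by (simp add: k_def)
      have "t (l + 2) + (i - 1 + j) < t (l + 3)" using lt s by (simp add: t_def)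
      then have "tribonacci (Suc (t (l + 2) + (i - 1 + j))) = sigma_pow (l + 3) ! (t (l + 2) + (i - 1 + j))"
        by (rule tribonacci_nth)
      also have "\<dots> = sigma_pow k ! (i - 1 + j)"
        using lt by (simp add: s t_def nth_append)
      also have "Suc (t (l + 2) + (i - 1 + j)) = t (l + 2) + i + j" using i1 by simp
      finally show "tribonacci (t (l + 2) + i + j) = w ! j" using wj[OF j] by simp
    qed (use i1 in simp)
    moreover have "N < t (l + 2) + i" using t_gt[of "l + 2"] by (simp add: l_def)
    ultimately show "\<exists>n>N. n \<in> {i. occurs_at w i}" by blast
  qed
qed

end

(* Let b_k be the length of the bispecial word B_k given by B_0 = empty, B_(k+1) = sigma(B_k) a.
   A maximal coincidence T[x+1..x+e] = T[y+1..y+e] with e > 0 is sigma(w) a for a shorter maximal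
   coincidence w of the Tribonacci word T, because sigma-blocks begin exactly at the letters a.
   Iterating, x = |sigma^k(T[1..x0])|, y = |sigma^k(T[1..y0])| and the common word is B_k. A square
   of half-length y - x needs y - x <= b_k, and this forces y0 = x0 + 1, as two consecutive letters
   already have an image under sigma^k longer than b_k.

   Moreover Gamma_{1,m,1} is the interval (t_(m-1) + b_(m-2), t_(m-1) + b_(m-1)], and the prefix of
   T of length t_(m-1) + b_(m-1) has period t_(m-1). Hence squares ending at n - t_(m-1) are
   moved to squares ending at n. By the classification, a square that ends at n but begins within
   the first t_(m-1) letters has half-length t_(m-1). Therefore
   a(n) = a(n - t_(m-1)) + [n >= 2 t_(m-1)], and the sets Gamma_{3,m-1,1}, Gamma_{2,m-1,1},
   Gamma_{1,m-1,1}, which are adjacent in this order, fill the translate (b_(m-2), b_(m-1)]. *)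

theory Submission
  imports Defs
begin

section \<open>The substitution on factors\<close>

text \<open>The letters at positions \<open>x + 1, \<dots>, x + e\<close>: with positions numbered from 1, offsets
  such as \<open>x\<close> count the letters that come before.\<close>
definition seg :: "nat \<Rightarrow> nat \<Rightarrow> letter list" where
  "seg x e = map tribonacci [Suc x..<Suc (x + e)]"

text \<open>The offset at which the \<open>sigma\<close>-block of letter number \<open>x + 1\<close>
  begins.\<close>

definition cut :: "nat \<Rightarrow> nat" where
  "cut x = length (sigma (prefix_of tribonacci x))"

fun bisp :: "nat \<Rightarrow> letter list" where
  "bisp 0 = []"
| "bisp (Suc k) = sigma (bisp k) @ [La]"

lemma length_seg [simp]: "length (seg x e) = e"
  by (simp add: seg_def)

lemma nth_seg [simp]: "i < e \<Longrightarrow> seg x e ! i = tribonacci (Suc (x + i))"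
  by (simp add: seg_def del: upt_Suc)

lemma seg_eq_iff: "seg x e = seg y e \<longleftrightarrow> (\<forall>i<e. tribonacci (Suc (x + i)) = tribonacci (Suc (y + i)))"
  by (auto simp: list_eq_iff_nth_eq)

lemma seg_0 [simp]: "seg x 0 = []"
  by (simp add: seg_def)

lemma seg_add: "seg x (e + f) = seg x e @ seg (x + e) f"
  by (rule nth_equalityI) (auto simp: nth_append add.assoc)

lemma seg_Suc: "seg x (Suc e) = seg x e @ [tribonacci (Suc (x + e))]"
  using seg_add[of x e 1] by (simp add: seg_def)

lemma seg_sub:
  assumes "seg x e = seg y e" "u + f \<le> e"
  shows "seg (x + u) f = seg (y + u) f"
  using assms by (auto simp: seg_eq_iff add.assoc)

lemma prefix_of_eq_seg: "prefix_of tribonacci n = seg 0 n"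
  by (simp add: prefix_of_def seg_def)

lemma sigma_Nil [simp]: "sigma [] = []"
  by (simp add: sigma_def)

lemma cut_0 [simp]: "cut 0 = 0"
  by (simp add: cut_def prefix_of_def)

lemma sigma_prefix: "sigma (seg 0 n) = seg 0 (cut n)"
  using tribonacci_fixed_point by (simp add: is_fixed_point_def cut_def prefix_of_eq_seg)

lemma cut_add: "cut (x + e) = cut x + length (sigma (seg x e))"
  by (simp add: cut_def prefix_of_eq_seg seg_add sigma_append)

lemma sigma_seg: "sigma (seg x e) = seg (cut x) (length (sigma (seg x e)))"
proof -
  have "sigma (seg 0 x) @ sigma (seg x e) = seg 0 (cut x + length (sigma (seg x e)))"
    using sigma_prefix[of "x + e"] by (simp add: seg_add sigma_append cut_add)
  also have "\<dots> = sigma (seg 0 x) @ seg (cut x) (length (sigma (seg x e)))"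
    by (simp add: seg_add sigma_prefix)
  finally show ?thesis by simp
qed

lemma cut_Suc: "cut (Suc x) = cut x + length (sigma_letter (tribonacci (Suc x)))"
  using cut_add[of x 1] by (simp add: seg_def sigma_def)

lemma tribonacci_block:
  assumes "j < length (sigma_letter (tribonacci (Suc x)))"
  shows "tribonacci (Suc (cut x + j)) = sigma_letter (tribonacci (Suc x)) ! j"
proof -
  have "sigma (seg x 1) = sigma_letter (tribonacci (Suc x))"
    by (simp add: seg_def sigma_def)
  then have "sigma_letter (tribonacci (Suc x)) =
      seg (cut x) (length (sigma_letter (tribonacci (Suc x))))"
    using sigma_seg[of x 1] by simp
  then show ?thesis using assms nth_seg by metis
qed

lemma tribonacci_cut_1 [simp]: "tribonacci (Suc (cut x)) = La"
  using tribonacci_block[of 0 x] by (cases "tribonacci (Suc x)") auto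

lemma cut_less_Suc: "cut x < cut (Suc x)"
  by (cases "tribonacci (Suc x)") (auto simp: cut_Suc)

lemma strict_mono_cut: "strict_mono cut"
  by (simp add: strict_mono_Suc_iff cut_less_Suc)

lemma cut_gt:
  assumes "0 < x" shows "x < cut x"
  using assms
proof (induction x rule: nat_induct_non_zero)
  case 1
  then show ?case using cut_Suc[of 0] tribonacci_1 by simp
next
  case (Suc n)
  then show ?case using cut_less_Suc[of n] by simp
qed

lemma in_block: "\<exists>x. cut x \<le> i \<and> i < cut (Suc x)"
proof (induction i)
  case 0
  then show ?case using cut_less_Suc[of 0] cut_0 by (metis order.refl)
next
  case (Suc i)
  then obtain x where "cut x \<le> i" "i < cut (Suc x)" by blast
  then show ?case using cut_less_Suc[of "Suc x"] by (metis Suc_lessI le_SucI order.refl)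
qed

text \<open>Each block is \<open>La\<close> followed by at most one other letter, so an
  \<open>La\<close> always opens a block and any other letter comes right after one. This makes
  desubstitution possible.\<close>

lemma La_cases: "(\<exists>x. i = cut x) \<and> tribonacci (Suc i) = La \<or>
    i > 0 \<and> tribonacci i = La \<and> tribonacci (Suc i) \<noteq> La"
proof -
  obtain x where x: "cut x \<le> i" "i < cut (Suc x)" using in_block by blast
  show ?thesis
  proof (cases "i = cut x")
    case False
    then have i: "i = Suc (cut x)" "1 < length (sigma_letter (tribonacci (Suc x)))"
      using x by (cases "tribonacci (Suc x)"; simp add: cut_Suc)+
    then have "tribonacci (Suc i) \<noteq> La"
      using tribonacci_block[of 1 x] by (cases "tribonacci (Suc x)") auto
    then show ?thesis using i by simp
  qed auto
qed

text \<open>A block of length one is followed by the opening \<open>La\<close> of the next block.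
  Hence the letter after an opening \<open>La\<close> determines the preimage letter.\<close>

lemma tribonacci_cut_2:
  "tribonacci (Suc (Suc (cut x))) =
    (case tribonacci (Suc x) of La \<Rightarrow> Lb | Lb \<Rightarrow> Lc | Lc \<Rightarrow> La)"
proof (cases "tribonacci (Suc x)")
  case Lc
  then have "cut (Suc x) = Suc (cut x)" by (simp add: cut_Suc)
  then show ?thesis using tribonacci_cut_1[of "Suc x"] Lc by simp
qed (use tribonacci_block[of 1 x] in auto)

lemma tribonacci_cut_2_neq:
  "tribonacci (Suc x) \<noteq> tribonacci (Suc y) \<Longrightarrow>
    tribonacci (Suc (Suc (cut x))) \<noteq> tribonacci (Suc (Suc (cut y)))"
  by (auto simp: tribonacci_cut_2 split: letter.splits)

lemma tribonacci_cut_last: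
  "tribonacci (cut (Suc x)) = last (sigma_letter (tribonacci (Suc x)))"
proof (cases "tribonacci (Suc x)")
  case Lc
  then show ?thesis using tribonacci_block[of 0 x] by (simp add: cut_Suc)
qed (use tribonacci_block[of 1 x] in \<open>auto simp: cut_Suc\<close>)

lemma seg_cut:
  "seg (cut x) (Suc (length (sigma (seg x e)))) = sigma (seg x e) @ [La]"
proof -
  have "tribonacci (Suc (cut x + length (sigma (seg x e)))) = La"
    using tribonacci_cut_1[of "x + e"] by (simp add: cut_add)
  then show ?thesis by (simp add: seg_Suc flip: sigma_seg)
qed

section \<open>Maximal coincidences\<close>

text \<open>Where the preimages first differ, both images still open with \<open>La\<close>, and
  only the letters after it differ. This accounts for the extra \<open>La\<close>.\<close>

lemma cut_match:
  assumes match: "seg x e = seg y e"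
    and neq: "tribonacci (Suc (x + e)) \<noteq> tribonacci (Suc (y + e))"
    and l: "l = Suc (length (sigma (seg x e)))"
  shows "seg (cut x) l = sigma (seg x e) @ [La]"
    and "seg (cut y) l = sigma (seg x e) @ [La]"
    and "tribonacci (Suc (cut x + l)) \<noteq> tribonacci (Suc (cut y + l))"
proof -
  show "seg (cut x) l = sigma (seg x e) @ [La]"
    unfolding l by (rule seg_cut)
  show "seg (cut y) l = sigma (seg x e) @ [La]"
    unfolding l match by (rule seg_cut)
  show "tribonacci (Suc (cut x + l)) \<noteq> tribonacci (Suc (cut y + l))"
    using tribonacci_cut_2_neq[OF neq] by (simp add: cut_add l match)
qed

lemma match_end:
  assumes "tribonacci (Suc (x + i)) \<noteq> tribonacci (Suc (y + i))"
  obtains e where "e \<le> i" "seg x e = seg y e"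
    "tribonacci (Suc (x + e)) \<noteq> tribonacci (Suc (y + e))"
proof -
  define e where "e = (LEAST i. tribonacci (Suc (x + i)) \<noteq> tribonacci (Suc (y + i)))"
  have "tribonacci (Suc (x + e)) \<noteq> tribonacci (Suc (y + e))"
    unfolding e_def by (rule LeastI[of _ i]) (rule assms)
  moreover have "e \<le> i" unfolding e_def by (rule Least_le) (rule assms)
  moreover have "seg x e = seg y e"
    using not_less_Least[of _ "\<lambda>i. tribonacci (Suc (x + i)) \<noteq> tribonacci (Suc (y + i))"]
    unfolding seg_eq_iff e_def by blast
  ultimately show ?thesis using that by blast
qed

text \<open>Infinite descent: a coincidence of two tails desubstitutes to one with a smaller \<open>y\<close>.\<close>
lemma not_eventually_periodic:
  "x < y \<Longrightarrow> \<exists>i. tribonacci (Suc (x + i)) \<noteq> tribonacci (Suc (y + i))"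
proof (induction y arbitrary: x rule: less_induct)
  case (less y)
  show ?case
  proof (rule ccontr)
    assume "\<not> ?case"
    then have eq: "tribonacci (Suc (x + i)) = tribonacci (Suc (y + i))" for i by blast
    from eq[of 0] have eq0: "tribonacci (Suc x) = tribonacci (Suc y)" by simp
    show False
    proof (cases "tribonacci (Suc x) = La")
      case True
      then obtain x' y' where xy: "x = cut x'" "y = cut y'"
        using La_cases[of x] La_cases[of y] eq0 by auto
      then have "x' < y'" using less.prems strict_mono_cut by (simp add: strict_mono_less)
      moreover have "y' < y" using cut_gt[of y'] xy \<open>x' < y'\<close> by simp
      ultimately obtain i where "tribonacci (Suc (x' + i)) \<noteq> tribonacci (Suc (y' + i))"
        using less.IH by blast
      then obtain e where "seg x' e = seg y' e"
          "tribonacci (Suc (x' + e)) \<noteq> tribonacci (Suc (y' + e))"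
        by (rule match_end)
      from cut_match(3)[OF this refl] show False using eq xy by blast
    next
      case False
      \<comment> \<open>Both offsets lie inside a block, with an \<open>La\<close> in front. As
        these two letters agree, the mismatch supplied by the induction has
        \<open>i \<noteq> 0\<close> and lies in the original tails.\<close>
      then have x: "x > 0" "tribonacci x = tribonacci y"
        using La_cases[of x] La_cases[of y] eq0 by auto
      then obtain i where i: "tribonacci (Suc (x - 1 + i)) \<noteq> tribonacci (Suc (y - 1 + i))"
        using less.IH[of "y - 1" "x - 1"] less.prems diff_less_mono[of x y 1] by fastforce
      then have "i \<noteq> 0" using x less.prems by (metis Suc_pred' add_0_right less_trans)
      then show False using i x eq[of "i - 1"] less.prems by simp
    qed
  qed
qed

lemma maximal_match:
  assumes "x < y" "seg x e = seg y e"
    and "tribonacci (Suc (x + e)) \<noteq> tribonacci (Suc (y + e))"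
    and "x = 0 \<or> tribonacci x \<noteq> tribonacci y"
  shows "\<exists>k x0 y0. x = (cut ^^ k) x0 \<and> y = (cut ^^ k) y0 \<and> seg x e = bisp k"
  using assms
proof (induction e arbitrary: x y rule: less_induct)
  case (less e)
  show ?case
  proof (cases "e = 0")
    case True
    then show ?thesis by (auto intro: exI[of _ 0])
  next
    case False
    then have eq0: "tribonacci (Suc x) = tribonacci (Suc y)"
      using less.prems(2) by (auto simp: seg_eq_iff dest: spec[of _ 0])
    \<comment> \<open>Otherwise both offsets would be preceded by \<open>La\<close>, against
      maximality on the left.\<close>
    then have "tribonacci (Suc x) = La"
      using La_cases[of x] La_cases[of y] less.prems(4) by auto
    then obtain x' y' where xy: "x = cut x'" "y = cut y'"
      using La_cases[of x] La_cases[of y] eq0 by auto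
    then have "x' < y'" using less.prems(1) strict_mono_cut by (simp add: strict_mono_less)
    then obtain i where "tribonacci (Suc (x' + i)) \<noteq> tribonacci (Suc (y' + i))"
      using not_eventually_periodic by blast
    then obtain f where f: "seg x' f = seg y' f"
        "tribonacci (Suc (x' + f)) \<noteq> tribonacci (Suc (y' + f))"
      by (rule match_end)
    define l where "l = Suc (length (sigma (seg x' f)))"
    note m = cut_match[OF f l_def, folded xy]
    \<comment> \<open>Both \<open>e\<close> and \<open>l\<close> mark the first mismatch to the
      right of \<open>x\<close> and \<open>y\<close>.\<close>
    have "e = l"
    proof (rule linorder_cases)
      assume "e < l"
      then show ?thesis using less.prems(3) m(1,2) seg_eq_iff[of x l y] by simp
    next
      assume "l < e"
      then show ?thesis using less.prems(2) m(3) seg_eq_iff[of x e y] by simp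
    qed
    then have "f < e" using length_sigma[of "seg x' f"] by (simp add: l_def)
    \<comment> \<open>Equal letters before the preimages would have images with the same last
      letter, so maximality on the left descends.\<close>
    moreover have "x' = 0 \<or> tribonacci x' \<noteq> tribonacci y'"
    proof (rule ccontr)
      assume "\<not> ?thesis"
      then obtain u v where "x' = Suc u" "y' = Suc v" "tribonacci (Suc u) = tribonacci (Suc v)"
        using \<open>x' < y'\<close> by (metis gr0_implies_Suc less_trans neq0_conv)
      then have "tribonacci x = tribonacci y" "x > 0"
        using xy tribonacci_cut_last cut_gt[of x'] by simp_all
      then show False using less.prems(4) by simp
    qed
    ultimately obtain k x0 y0 where "x' = (cut ^^ k) x0" "y' = (cut ^^ k) y0" "seg x' f = bisp k"
      using less.IH[OF _ \<open>x' < y'\<close> f] by blast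
    then have "x = (cut ^^ Suc k) x0" "y = (cut ^^ Suc k) y0" "seg x e = bisp (Suc k)"
      using xy m(1) \<open>e = l\<close> by simp_all
    then show ?thesis by blast
  qed
qed

section \<open>Iterated cuts and the lengths of the bispecial words\<close>

lemma strict_mono_cut_funpow: "strict_mono (cut ^^ k)"
  by (induction k) (use strict_mono_cut in \<open>auto simp: strict_mono_def\<close>)

lemma cut_funpow_add: "(cut ^^ k) (x + e) = (cut ^^ k) x + length ((sigma ^^ k) (seg x e))"
proof -
  \<comment> \<open>The second conjunct strengthens the induction: it presents the iterated image as
    a factor to which \<open>cut_add\<close> applies.\<close>
  have "(cut ^^ k) (x + e) = (cut ^^ k) x + length ((sigma ^^ k) (seg x e)) \<and>
      (sigma ^^ k) (seg x e) = seg ((cut ^^ k) x) (length ((sigma ^^ k) (seg x e)))"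
  proof (induction k)
    case (Suc k)
    then show ?case by (metis comp_apply cut_add funpow.simps(2) sigma_seg)
  qed simp
  then show ?thesis ..
qed

lemma cut_t: "cut (t k) = t (Suc k)"
proof -
  have "prefix_of tribonacci (t k) = sigma_pow k"
    using prefix_of_tribonacci[of "t k" k] by (simp add: t_def)
  then show ?thesis by (simp add: cut_def t_def sigma_pow_def)
qed

lemma cut_funpow_t: "(cut ^^ k) (t j) = t (k + j)"
  by (induction k) (simp_all add: cut_t)

lemma t_0 [simp]: "t 0 = 1"
  by (simp add: t_def sigma_pow_def)

lemma cut_funpow_0 [simp]: "(cut ^^ k) 0 = 0"
  by (induction k) simp_all

lemma cut_funpow_1: "(cut ^^ k) (Suc 0) = t k"
  using cut_funpow_t[of k 0] by simp

lemma strict_mono_t: "strict_mono t"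
proof -
  have "t m < t (Suc m)" for m
    using cut_gt[of "t m"] t_gt[of m] by (simp add: cut_t)
  then show ?thesis by (simp add: strict_mono_Suc_iff)
qed

text \<open>Each application of \<open>sigma\<close> appends the \<open>La\<close> that opens the
  next block, so the word after a level-\<open>k\<close> cut does not depend on \<open>x\<close> up
  to this length.\<close>

lemma bisp_eq_seg: "seg ((cut ^^ k) x) (length (bisp k)) = bisp k"
proof (induction k)
  case (Suc k)
  then show ?case using seg_cut[of "(cut ^^ k) x" "length (bisp k)"] by simp
qed simp

text \<open>Applying \<open>sigma\<close> and appending \<open>La\<close> raises \<open>k\<close> by
  one in this identity. It gives a recursion for the lengths.\<close>

lemma bisp_Suc: "bisp (Suc k) = sigma_pow k @ bisp k"
proof (induction k)
  case (Suc k)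
  have "bisp (Suc (Suc k)) = sigma (bisp (Suc k)) @ [La]" by simp
  also have "\<dots> = sigma (sigma_pow k) @ sigma (bisp k) @ [La]"
    unfolding Suc.IH by (simp add: sigma_append)
  finally show ?case by (simp add: sigma_pow_def)
qed (simp add: sigma_pow_def)

lemma length_bisp_Suc: "length (bisp (Suc k)) = t k + length (bisp k)"
  unfolding bisp_Suc by (simp add: t_def)

lemma length_bisp_mono: "j \<le> k \<Longrightarrow> length (bisp j) \<le> length (bisp k)"
  by (rule lift_Suc_mono_le[of "\<lambda>k. length (bisp k)"]) (simp only: length_bisp_Suc)

lemma t_1 [simp]: "t (Suc 0) = 2"
  by (simp add: t_def sigma_pow_def sigma_def)

lemma t_2: "t 2 = 4"
  by (simp add: t_def sigma_pow_def sigma_def numeral_eq_Suc)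

text \<open>The halves in the bounds of \<open>Gamma1\<close>, \<open>Gamma2\<close> and
  \<open>Gamma3\<close> come from this closed form.\<close>

lemma length_bisp: "2 * length (bisp (Suc k)) + 3 = t (k + 2) + t k"
proof (induction k)
  case (Suc k)
  then show ?case
    using t_rec[of k] length_bisp_Suc[of "Suc k"] by (simp add: numeral_eq_Suc)
qed (use t_2 in \<open>simp add: numeral_eq_Suc\<close>)

text \<open>Two instances of the recurrence give \<open>t (h + 4) = 2 * t (h + 3) - t h\<close>;
  smaller indices are checked by value.\<close>

lemma t_Suc_le: "t (Suc k) \<le> 2 * t k"
proof (cases k)
  case (Suc j)
  show ?thesis
  proof (cases j)
    case 0
    then show ?thesis using Suc t_2 by (simp add: numeral_eq_Suc)
  next
    case j: (Suc i)
    show ?thesis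
    proof (cases i)
      case 0
      then show ?thesis using Suc j t_2 t_rec[of 0] by (simp add: numeral_eq_Suc)
    next
      case (Suc h)
      then show ?thesis using \<open>k = Suc j\<close> j t_rec[of h] t_rec[of "Suc h"]
        by (simp add: numeral_eq_Suc)
    qed
  qed
qed simp

lemma length_bisp_less: "length (bisp k) < t (Suc k)"
proof (cases k)
  case (Suc j)
  have "t j < t (Suc (Suc j))" using strict_mono_t by (simp add: strict_mono_less)
  then show ?thesis using length_bisp[of j] Suc by (simp add: numeral_eq_Suc)
qed simp

lemma t_le_sigma_funpow: "t k \<le> length ((sigma ^^ Suc k) [z])"
proof -
  obtain v where "sigma [z] = [La] @ v" by (cases z) (auto simp: sigma_def)
  then have "(sigma ^^ Suc k) [z] = (sigma ^^ k) [La] @ (sigma ^^ k) v"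
    by (simp add: funpow_swap1 del: funpow.simps flip: sigma_funpow_append)
       (simp add: funpow_swap1)
  then show ?thesis by (simp add: t_def sigma_pow_def)
qed

lemma length_bisp_less_La:
  "length (bisp k) < t k + length ((sigma ^^ k) [z])"
proof (cases k)
  case (Suc j)
  then show ?thesis
    using t_le_sigma_funpow[of j z] length_bisp_Suc[of j] length_bisp_less[of j] by simp
qed simp

text \<open>Of two consecutive letters at least one is \<open>La\<close>, whose iterated image has
  length \<open>t k\<close>, and \<open>length_bisp_less_La\<close> covers the other.\<close>

lemma cut_funpow_gap: "(cut ^^ k) x + length (bisp k) < (cut ^^ k) (x + 2)"
proof -
  have "seg x 2 = [tribonacci (Suc x)] @ [tribonacci (Suc (Suc x))]"
    by (simp add: seg_def numeral_eq_Suc)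
  then have "length ((sigma ^^ k) (seg x 2)) =
      length ((sigma ^^ k) [tribonacci (Suc x)]) + length ((sigma ^^ k) [tribonacci (Suc (Suc x))])"
    by (simp only: sigma_funpow_append length_append)
  moreover have "tribonacci (Suc x) = La \<or> tribonacci (Suc (Suc x)) = La"
    using La_cases[of x] La_cases[of "Suc x"] by auto
  ultimately have "length (bisp k) < length ((sigma ^^ k) (seg x 2))"
    using length_bisp_less_La[of k "tribonacci (Suc x)"]
      length_bisp_less_La[of k "tribonacci (Suc (Suc x))"]
    by (auto simp: t_def sigma_pow_def)
  then show ?thesis unfolding cut_funpow_add by simp
qed

section \<open>Repetitions of at least two periods\<close>

lemma match_start:
  assumes "seg s f = seg (s + d) f"
  obtains x where "x \<le> s" "seg x (s - x + f) = seg (x + d) (s - x + f)"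
    "x = 0 \<or> tribonacci x \<noteq> tribonacci (x + d)"
proof -
  define P where "P x \<longleftrightarrow> x \<le> s \<and> seg x (s - x + f) = seg (x + d) (s - x + f)" for x
  define x where "x = (LEAST x. P x)"
  have "P s" using assms by (simp add: P_def)
  then have Px: "P x" unfolding x_def by (rule LeastI)
  have "x = 0 \<or> tribonacci x \<noteq> tribonacci (x + d)"
  proof (rule ccontr)
    assume "\<not> ?thesis"
    then obtain u where u: "x = Suc u" "tribonacci (Suc u) = tribonacci (Suc (u + d))"
      by (cases x) auto
    have "P u" unfolding P_def seg_eq_iff
    proof (intro conjI allI impI)
      fix i assume "i < s - u + f"
      then show "tribonacci (Suc (u + i)) = tribonacci (Suc (u + d + i))"
        using Px u unfolding P_def seg_eq_iff by (cases i) auto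
    qed (use Px u in \<open>simp add: P_def\<close>)
    then show False using not_less_Least[of u P] u by (simp add: x_def)
  qed
  then show ?thesis using Px that[of x] unfolding P_def by blast
qed

text \<open>The \<open>d + f\<close> letters after \<open>s\<close> have period \<open>d\<close>,
  and \<open>d \<le> f\<close> makes room for two periods. The maximal extension of the coincidence
  is \<open>bisp k\<close> with \<open>d \<le> length (bisp k)\<close>, so
  \<open>cut_funpow_gap\<close> leaves only adjacent level-\<open>k\<close> cuts.\<close>

lemma repetition_structure:
  assumes "0 < d" "d \<le> f" "seg s f = seg (s + d) f"
  obtains k x where "(cut ^^ k) x \<le> s" "(cut ^^ k) (Suc x) = (cut ^^ k) x + d"
    "s + f \<le> (cut ^^ k) x + length (bisp k)"
proof -
  from assms(3) obtain x where x: "x \<le> s" "seg x (s - x + f) = seg (x + d) (s - x + f)"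
    "x = 0 \<or> tribonacci x \<noteq> tribonacci (x + d)"
    by (rule match_start)
  obtain i where "tribonacci (Suc (x + i)) \<noteq> tribonacci (Suc (x + d + i))"
    using not_eventually_periodic[of x "x + d"] assms(1) by auto
  then obtain e where e: "seg x e = seg (x + d) e"
      "tribonacci (Suc (x + e)) \<noteq> tribonacci (Suc (x + d + e))"
    by (rule match_end)
  then obtain k x0 y0 where k: "x = (cut ^^ k) x0" "x + d = (cut ^^ k) y0" "seg x e = bisp k"
    using maximal_match[of x "x + d" e] x assms(1) by auto
  then have e_eq: "e = length (bisp k)" using length_seg[of x e] by simp
  have "s - x + f \<le> e"
    using x(2) e(2) unfolding seg_eq_iff by (meson not_le)
  then have sf: "s + f \<le> x + length (bisp k)" using x(1) e_eq by simp
  have "x0 < y0" using k assms(1) strict_mono_less[OF strict_mono_cut_funpow[of k], of x0 y0] by simp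
  moreover have "(cut ^^ k) y0 < (cut ^^ k) (x0 + 2)"
    using cut_funpow_gap[of k x0] sf x(1) assms(2) k by simp
  then have "y0 < x0 + 2" by (simp add: strict_mono_less[OF strict_mono_cut_funpow])
  ultimately have "y0 = Suc x0" by simp
  then show ?thesis using that[of k x0] k x(1) sf by simp
qed

section \<open>Squares\<close>

text \<open>The last condition makes the two halves consecutive occurrences, since \<open>is_square\<close> compares
  \<open>\<omega>\<^sub>p\<close> with the very next occurrence.\<close>
definition ends_square :: "nat \<Rightarrow> nat \<Rightarrow> bool" where
  "ends_square n l \<longleftrightarrow> 0 < l \<and> 2 * l \<le> n \<and> seg (n - 2 * l) l = seg (n - l) l \<and>
     (\<forall>d. 0 < d \<and> d < l \<longrightarrow> seg (n - 2 * l + d) l \<noteq> seg (n - l) l)"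

lemma occurs_at_iff: "occurs_at w (Suc i) \<longleftrightarrow> seg i (length w) = w"
  by (auto simp: occurs_at_def list_eq_iff_nth_eq)

lemma not_occurs_at_0 [simp]: "\<not> occurs_at w 0"
  by (simp add: occurs_at_def)

lemma occurs_at_occ_start:
  "is_factor w \<Longrightarrow> occurs_at w (occ_start w p)"
  using enumerate_in_set[OF infinite_occurrences] by (auto simp: occ_start_def)

lemma occ_start_inj:
  assumes "is_factor w" "1 \<le> p" "1 \<le> q" "occ_start w p = occ_start w q"
  shows "p = q"
  using assms strict_mono_eq[OF strict_mono_enumerate[OF infinite_occurrences[OF assms(1)]]]
  by (auto simp: occ_start_def)

lemma occ_start_next:
  assumes "is_factor w" "1 \<le> p"
  shows "occ_start w (p + 1) = (LEAST i. occurs_at w i \<and> occ_start w p < i)"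
proof -
  obtain q where "p = Suc q" using assms(2) by (cases p) auto
  then show ?thesis
    using enumerate_Suc''[OF infinite_occurrences[OF assms(1)], of q] by (simp add: occ_start_def)
qed

text \<open>Given \<open>n\<close>, the half-length fixes the word and its starting position, and
  this position fixes \<open>p\<close>.\<close>

lemma a_eq_card: "a n = card {l. ends_square n l}"
proof -
  define A where
    "A = {(w, p). w \<noteq> [] \<and> is_factor w \<and> p \<ge> 1 \<and> is_square w p \<and> occ_end w (p + 1) = n}"
  have A: "w = seg (n - length w) (length w) \<and> ends_square n (length w) \<and>
      occ_start w p = Suc (n - 2 * length w)"
    if "(w, p) \<in> A" for w p
  proof -
    from that have w: "w \<noteq> []" "is_factor w" "1 \<le> p"
      and sq: "occ_start w (p + 1) = occ_start w p + length w"
      and n: "occ_start w (p + 1) + length w = Suc n"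
      by (auto simp: A_def is_square_def occ_end_def Suc_le_eq)
    obtain s where s: "occ_start w p = Suc s"
      using occurs_at_occ_start[OF w(2), of p] not_occurs_at_0 by (metis not0_implies_Suc)
    have ns: "n = s + 2 * length w" using s sq n by simp
    have eq: "seg s (length w) = w" "seg (s + length w) (length w) = w"
      using occurs_at_occ_start[OF w(2), of p] occurs_at_occ_start[OF w(2), of "p + 1"] s sq
      by (simp_all add: occurs_at_iff)
    have "seg (s + d) (length w) \<noteq> w" if "0 < d" "d < length w" for d
    proof
      assume "seg (s + d) (length w) = w"
      then have "occurs_at w (Suc (s + d))" by (simp add: occurs_at_iff)
      then have "occ_start w (p + 1) \<le> Suc (s + d)"
        unfolding occ_start_next[OF w(2,3)] using s that by (intro Least_le) simp
      then show False using s sq that by simp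
    qed
    moreover have n_diff: "n - length w = s + length w" "n - 2 * length w = s"
      by (simp_all add: ns)
    ultimately show ?thesis
      unfolding ends_square_def n_diff eq s using w(1) by (simp add: ns)
  qed
  have "inj_on (\<lambda>(w, p). length w) A"
  proof (rule inj_onI, clarify)
    fix v p w q assume vw: "(v, p) \<in> A" "(w, q) \<in> A" "length v = length w"
    then have "v = w" using A[OF vw(1)] A[OF vw(2)] by simp
    moreover have "p = q"
    proof (rule occ_start_inj[of v])
      show "occ_start v p = occ_start v q" using A[OF vw(1)] A[OF vw(2)] \<open>v = w\<close> by simp
    qed (use vw \<open>v = w\<close> in \<open>auto simp: A_def\<close>)
    ultimately show "v = w \<and> p = q" by simp
  qed
  moreover have "(\<lambda>(w, p). length w) ` A = {l. ends_square n l}"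
  proof (intro set_eqI iffI)
    fix l assume "l \<in> {l. ends_square n l}"
    then have l: "ends_square n l" by simp
    define w where "w = seg (n - l) l"
    define s where "s = n - 2 * l"
    have lens: "0 < l" "n = s + 2 * l" "length w = l"
      using l by (simp_all add: ends_square_def s_def w_def)
    have ws: "occurs_at w (Suc s)" "occurs_at w (Suc (s + l))"
      "\<And>d. 0 < d \<Longrightarrow> d < l \<Longrightarrow> \<not> occurs_at w (Suc (s + d))"
      using l lens by (auto simp: ends_square_def occurs_at_iff w_def add.commute)
    then have fac: "is_factor w" by (auto simp: is_factor_def)
    \<comment> \<open>The enumeration counts from 0, so the occurrence number is
      \<open>q + 1\<close>.\<close>
    obtain q where "enumerate {i. occurs_at w i} q = Suc s"
      using enumerate_Ex[of "{i. occurs_at w i}" "Suc s"] infinite_occurrences[OF fac] ws(1) by auto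
    then have q: "occ_start w (q + 1) = Suc s" by (simp add: occ_start_def)
    have "occ_start w (q + 1 + 1) = (LEAST i. occurs_at w i \<and> Suc s < i)"
      using occ_start_next[OF fac, of "q + 1"] q by simp
    also have "\<dots> = Suc (s + l)"
    proof (rule Least_equality)
      show "occurs_at w (Suc (s + l)) \<and> Suc s < Suc (s + l)" using ws lens by simp
      fix i assume i: "occurs_at w i \<and> Suc s < i"
      show "Suc (s + l) \<le> i"
      proof (rule ccontr)
        assume "\<not> ?thesis"
        then have "i - Suc s < l" using i by linarith
        then show False using ws(3)[of "i - Suc s"] i by simp
      qed
    qed
    finally have "(w, q + 1) \<in> A"
      using q lens fac by (auto simp: A_def is_square_def occ_end_def)
    then show "l \<in> (\<lambda>(w, p). length w) ` A" using lens by force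
  qed (use A in auto)
  ultimately show ?thesis unfolding a_def A_def[symmetric] by (metis card_image)
qed

section \<open>Translation by a Tribonacci number\<close>

text \<open>\<open>bisp k\<close> follows both of the first two level-\<open>k\<close> cuts,
  \<open>0\<close> and \<open>t k\<close>.\<close>

lemma t_periodic_prefix: "seg 0 (length (bisp k)) = seg (t k) (length (bisp k))"
  using bisp_eq_seg[of k 0] bisp_eq_seg[of k "Suc 0"] by (simp add: cut_funpow_1)

text \<open>The square and every window compared in its last condition lie within the first
  \<open>i\<close> letters, which recur after \<open>t k\<close>.\<close>

lemma ends_square_shift:
  assumes "i \<le> length (bisp k)" "2 * l \<le> i"
  shows "ends_square (t k + i) l \<longleftrightarrow> ends_square i l"
proof -
  have shift: "seg (t k + u) l = seg u l" if "u + l \<le> i" for u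
    using seg_sub[OF t_periodic_prefix[of k], of u l] that assms by simp
  have "t k + i - 2 * l = t k + (i - 2 * l)" "t k + i - l = t k + (i - l)"
    using assms by simp_all
  then show ?thesis
    using shift[of "i - 2 * l + d" for d] shift[of "i - 2 * l"] shift[of "i - l"] assms(2)
    unfolding ends_square_def by (auto simp: add.assoc)
qed

text \<open>Let \<open>j\<close> be the level given by \<open>repetition_structure\<close>. If
  \<open>j \<le> k\<close>, then \<open>t (Suc k)\<close> is itself a level-\<open>j\<close> cut,
  which bounds both \<open>f\<close> and the end of the repetition, against the last hypothesis. If
  \<open>j > k\<close>, the only level-\<open>j\<close> cut before \<open>t (Suc k)\<close> is
  \<open>0\<close>, so \<open>d = t j\<close>.\<close>

lemma repetition_early_start:
  assumes "0 < d" "d \<le> f" "seg s f = seg (s + d) f" "s < t (Suc k)"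
    and "length (bisp k) < f \<or> t (Suc k) + length (bisp k) < s + d + f"
  shows "\<exists>j>k. d = t j"
proof -
  obtain j x where j: "(cut ^^ j) x \<le> s" "(cut ^^ j) (Suc x) = (cut ^^ j) x + d"
    "s + f \<le> (cut ^^ j) x + length (bisp j)"
    using repetition_structure[OF assms(1-3)] by blast
  show ?thesis
  proof (cases "j > k")
    case True
    then have "t (Suc k) \<le> t j" using strict_mono_t by (simp add: strict_mono_less_eq)
    then have "(cut ^^ j) x < (cut ^^ j) (Suc 0)"
      using j(1) assms(4) by (simp only: cut_funpow_1)
    then have "x = 0" by (simp add: strict_mono_less[OF strict_mono_cut_funpow])
    then show ?thesis using j(2) True by (auto simp: cut_funpow_1)
  next
    case False
    then have "t (Suc k) = (cut ^^ j) (t (Suc k - j))" by (simp add: cut_funpow_t)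
    then have "x < t (Suc k - j)"
      using j(1) assms(4) strict_mono_less[OF strict_mono_cut_funpow[of j]]
      by (metis order.strict_trans1)
    then have "(cut ^^ j) (Suc x) \<le> t (Suc k)"
      using \<open>t (Suc k) = _\<close> by (simp add: strict_mono_less_eq[OF strict_mono_cut_funpow])
    moreover have "length (bisp j) \<le> length (bisp k)"
      using False by (simp add: length_bisp_mono)
    ultimately show ?thesis using j assms(5) by simp
  qed
qed

lemma ends_square_long:
  assumes "length (bisp k) < i" "i \<le> length (bisp (Suc k))" "i < 2 * l"
  shows "ends_square (t (Suc k) + i) l \<longleftrightarrow> l = t (Suc k) \<and> t (Suc k) \<le> i"
proof
  let ?n = "t (Suc k) + i"
  assume l: "ends_square ?n l"
  define s where "s = ?n - 2 * l"
  have s: "?n = s + 2 * l" "0 < l" "seg s l = seg (s + l) l"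
    using l by (auto simp: ends_square_def s_def)
  have "\<exists>j>k. l = t j"
  proof (rule repetition_early_start[OF s(2) order.refl s(3)])
    show "s < t (Suc k)" using s assms by linarith
    show "length (bisp k) < l \<or> t (Suc k) + length (bisp k) < s + l + l" using s assms by linarith
  qed
  then obtain j where j: "j > k" "l = t j" by blast
  \<comment> \<open>For \<open>j \<ge> k + 2\<close> the square would need at least
    \<open>2 * t (k + 2)\<close> letters, more than \<open>?n\<close>.\<close>
  have "j < Suc (Suc k)"
  proof (rule ccontr)
    assume "\<not> ?thesis"
    then have "t (Suc (Suc k)) \<le> t j" using strict_mono_t by (simp add: strict_mono_less_eq)
    moreover have "t (Suc k) < t (Suc (Suc k))" using strict_mono_t by (simp add: strict_mono_less)
    ultimately show False using s(1) j(2) assms(2) length_bisp_less[of "Suc k"] by linarith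
  qed
  then have "j = Suc k" using j by simp
  then show "l = t (Suc k) \<and> t (Suc k) \<le> i" using j s(1) by simp
next
  let ?n = "t (Suc k) + i"
  assume l: "l = t (Suc k) \<and> t (Suc k) \<le> i"
  define s where "s = i - t (Suc k)"
  have i: "i = s + t (Suc k)" using l by (simp add: s_def)
  have s: "?n - 2 * l = s" "?n - l = s + l" using l i by simp_all
  have l0: "0 < l" using l t_gt[of "Suc k"] by simp
  have "seg (0 + s) l = seg (t (Suc k) + s) l"
    using i l assms(2) by (intro seg_sub[OF t_periodic_prefix]) simp
  then have sq: "seg s l = seg (s + l) l" using l by (simp add: add.commute)
  have "i < 2 * t (Suc k)"
    using assms l by simp
  then have s_less: "s < t (Suc k)" using i by simp
  \<comment> \<open>Such a \<open>d\<close> would itself be the shift of a repetition with an early start.\<close>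
  have "seg (s + d) l \<noteq> seg (s + l) l" if "0 < d" "d < l" for d
  proof
    assume "seg (s + d) l = seg (s + l) l"
    then have "seg s l = seg (s + d) l" using sq by simp
    moreover have "length (bisp k) < l" using l length_bisp_less[of k] by simp
    ultimately have "\<exists>j>k. d = t j"
      using that s_less by (intro repetition_early_start[of d l s k]) simp_all
    then obtain j where "k < j" "d = t j" by blast
    then have "t (Suc k) \<le> d" using strict_mono_t by (simp add: strict_mono_less_eq)
    then show False using that l by simp
  qed
  then show "ends_square ?n l" unfolding ends_square_def s using l0 sq l by simp
qed

lemma a_shift:
  assumes "length (bisp k) < i" "i \<le> length (bisp (Suc k))"
  shows "a (t (Suc k) + i) = a i + of_bool (t (Suc k) \<le> i)"
proof -
  have iff: "ends_square (t (Suc k) + i) l \<longleftrightarrow> ends_square i l \<or> l = t (Suc k) \<and> t (Suc k) \<le> i" for l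
  proof (cases "2 * l \<le> i")
    case True
    \<comment> \<open>This excludes \<open>l = t (Suc k)\<close> in the present case.\<close>
    have "i < 2 * t (Suc k)"
      using assms(2) length_bisp_less[of "Suc k"] t_Suc_le[of "Suc k"] by linarith
    then show ?thesis using True ends_square_shift[OF assms(2) True] by auto
  next
    case False
    then show ?thesis using ends_square_long[OF assms, of l] by (auto simp: ends_square_def)
  qed
  \<comment> \<open>The new half-length is not yet present, so inserting it raises the count by
    one.\<close>
  have "\<not> ends_square i (t (Suc k))"
    using assms(2) length_bisp_less[of "Suc k"] t_Suc_le[of "Suc k"]
    by (simp add: ends_square_def del: bisp.simps)
  moreover have "finite {l. ends_square i l}"
    by (rule finite_subset[of _ "{..i}"]) (auto simp: ends_square_def)
  moreover have "{l. ends_square (t (Suc k) + i) l} =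
      (if t (Suc k) \<le> i then insert (t (Suc k)) {l. ends_square i l} else {l. ends_square i l})"
    by (auto simp: iff)
  ultimately show ?thesis by (simp add: a_eq_card)
qed

text \<open>The truncated difference counts the \<open>i\<close> from \<open>t (Suc k)\<close> to
  \<open>j\<close> and vanishes for \<open>j < t (Suc k)\<close>, so one formula serves all four
  cases.\<close>

lemma sum_a_shift:
  assumes "j \<le> length (bisp (Suc k))"
  shows "(\<Sum>i = t (Suc k) + Suc (length (bisp k))..t (Suc k) + j. a i) =
    (\<Sum>i = Suc (length (bisp k))..j. a i) + (Suc j - t (Suc k))"
proof -
  have "(\<Sum>i = t (Suc k) + Suc (length (bisp k))..t (Suc k) + j. a i) =
      (\<Sum>i = Suc (length (bisp k))..j. a (t (Suc k) + i))"
    using sum.shift_bounds_cl_nat_ivl[of a "Suc (length (bisp k))" "t (Suc k)" j]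
    by (simp only: add.commute)
  also have "\<dots> = (\<Sum>i = Suc (length (bisp k))..j. a i + of_bool (t (Suc k) \<le> i))"
    using assms by (intro sum.cong refl a_shift) simp_all
  also have "\<dots> = (\<Sum>i = Suc (length (bisp k))..j. a i) +
      card ({Suc (length (bisp k))..j} \<inter> {i. t (Suc k) \<le> i})"
    by (simp add: sum.distrib sum_of_bool_eq)
  also have "{Suc (length (bisp k))..j} \<inter> {i. t (Suc k) \<le> i} = {t (Suc k)..j}"
    using length_bisp_less[of k] by auto
  finally show ?thesis by simp
qed

section \<open>The sets of consecutive integers\<close>

lemma real_interval_eq:
  assumes "lo = real u" "hi = real v - 1"
  shows "{i. lo \<le> real i \<and> real i \<le> hi} = {u..<v}"
  unfolding assms by (auto simp: le_diff_eq simp flip: of_nat_Suc)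

lemma Min_atLeastLessThan_nat:
  "u < v \<Longrightarrow> Min {u..<v} = u" for u v :: nat
  by (rule Min_eqI) auto

text \<open>For \<open>m = k + 5\<close>, the three sets at index \<open>m - 1\<close> start at
  \<open>c\<close> and follow one another with \<open>t k\<close>, \<open>t (k + 1)\<close> and
  \<open>t (k + 2)\<close> elements. The thetas are their boundaries moved by
  \<open>t (m - 1)\<close>.\<close>

lemma Gamma_boundaries:
  fixes k :: nat
  defines "c \<equiv> Suc (length (bisp (k + 3)))"
  shows "Gamma3 (k + 4) = {c..<c + t k}"
    and "Gamma2 (k + 4) = {c + t k..<c + t k + t (k + 1)}"
    and "Gamma1 (k + 4) = {c + t k + t (k + 1)..<c + t (k + 3)}"
    and "Gamma1 (k + 5) = {t (k + 4) + c..<t (k + 4) + c + t (k + 3)}"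
    and "theta7 (k + 5) = t (k + 4) + c"
    and "theta8 (k + 5) = t (k + 4) + c + t k"
    and "theta9 (k + 5) = t (k + 4) + c + t k + t (k + 1)"
    and "theta10 (k + 5) = t (k + 4) + c + t (k + 3)"
proof -
  have "2 * c + 1 = t (k + 4) + t (k + 2)"
    using length_bisp[of "k + 2"] by (simp add: c_def eval_nat_numeral del: bisp.simps)
  then have c: "2 * real c + 1 = real (t (k + 4)) + real (t (k + 2))"
    by linarith
  have t_eqs: "real (t (k + 3)) = real (t (k + 2)) + real (t (k + 1)) + real (t k)"
    "real (t (k + 4)) = real (t (k + 3)) + real (t (k + 2)) + real (t (k + 1))"
    "real (t (k + 5)) = real (t (k + 4)) + real (t (k + 3)) + real (t (k + 2))"
    using t_rec[of k] t_rec[of "k + 1"] t_rec[of "k + 2"] by (simp_all add: eval_nat_numeral)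
  have diffs: "k + 4 - 1 = k + 3" "k + 4 - 2 = k + 2" "k + 5 - 1 = k + 4" "k + 5 - 2 = k + 3"
    by simp_all
  show "Gamma3 (k + 4) = {c..<c + t k}"
    unfolding Gamma3_def diffs by (rule real_interval_eq; use c t_eqs in \<open>simp; linarith\<close>)
  show "Gamma2 (k + 4) = {c + t k..<c + t k + t (k + 1)}"
    unfolding Gamma2_def diffs by (rule real_interval_eq; use c t_eqs in \<open>simp; linarith\<close>)
  show "Gamma1 (k + 4) = {c + t k + t (k + 1)..<c + t (k + 3)}"
    unfolding Gamma1_def diffs by (rule real_interval_eq; use c t_eqs in \<open>simp; linarith\<close>)
  show "Gamma1 (k + 5) = {t (k + 4) + c..<t (k + 4) + c + t (k + 3)}"
    unfolding Gamma1_def diffs by (rule real_interval_eq; use c t_eqs in \<open>simp; linarith\<close>)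
  show "theta7 (k + 5) = t (k + 4) + c"
    unfolding theta7_def diffs using c t_eqs by (simp; linarith)
  show "theta8 (k + 5) = t (k + 4) + c + t k"
    unfolding theta8_def diffs using c t_eqs by (simp; linarith)
  show "theta9 (k + 5) = t (k + 4) + c + t k + t (k + 1)"
    unfolding theta9_def diffs using c t_eqs by (simp; linarith)
  show "theta10 (k + 5) = t (k + 4) + c + t (k + 3)"
    unfolding theta10_def diffs using c t_eqs by (simp; linarith)
qed

section \<open>The four ranges of \<open>n\<close>\<close>

theorem mainTheorem10:
  fixes n m :: nat
  assumes "n \<ge> 21" and "m \<ge> 4" and "n \<in> Gamma1 m"
  shows "m \<ge> 5 \<and>
    (theta7 m \<le> real n \<and> real n < theta8 m \<longrightarrow>
       (\<Sum>i = Min (Gamma1 m)..n. a i) = (\<Sum>i = Min (Gamma3 (m-1))..n - t (m-1). a i)) \<and>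
    (theta8 m \<le> real n \<and> real n < theta9 m \<longrightarrow>
       (\<Sum>i = Min (Gamma1 m)..n. a i) =
         (\<Sum>i = Min (Gamma2 (m-1))..n - t (m-1). a i) + sum a (Gamma3 (m-1))) \<and>
    (theta9 m \<le> real n \<and> n < eta3 m \<longrightarrow>
       (\<Sum>i = Min (Gamma1 m)..n. a i) =
         (\<Sum>i = Min (Gamma1 (m-1))..n - t (m-1). a i)
           + sum a (Gamma3 (m-1)) + sum a (Gamma2 (m-1))) \<and>
    (\<not> (theta7 m \<le> real n \<and> real n < theta8 m) \<and>
     \<not> (theta8 m \<le> real n \<and> real n < theta9 m) \<and>
     \<not> (theta9 m \<le> real n \<and> n < eta3 m) \<longrightarrow>
       (\<Sum>i = Min (Gamma1 m)..n. a i) =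
         (\<Sum>i = Min (Gamma1 (m-1))..n - t (m-1). a i)
           + sum a (Gamma3 (m-1)) + sum a (Gamma2 (m-1)) + (n - eta3 m + 1)) \<and>
    (\<not> (theta7 m \<le> real n \<and> real n < theta8 m) \<and>
     \<not> (theta8 m \<le> real n \<and> real n < theta9 m) \<and>
     \<not> (theta9 m \<le> real n \<and> n < eta3 m) \<longleftrightarrow>
       eta3 m \<le> n \<and> real n < theta10 m)"
proof -
  \<comment> \<open>\<open>Gamma1 4\<close> ends at 14, below 21.\<close>
  have "m \<noteq> 4"
  proof
    assume "m = 4"
    moreover have "t 3 = 7" "t 4 = 13"
      using t_rec[of 0] t_rec[of 1] t_2 by (simp_all add: numeral_eq_Suc)
    ultimately show False using assms t_2 by (simp add: Gamma1_def)
  qed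
  then have "m \<ge> 5" using assms(2) by simp
  then obtain k where m: "m = k + 5" by (metis le_add_diff_inverse2)
  define c where "c = Suc (length (bisp (k + 3)))"
  note G = Gamma_boundaries[of k, folded c_def]
  have m1: "k + 5 - 1 = k + 4" by simp
  \<comment> \<open>\<open>j\<close> runs through the three adjacent sets at index
    \<open>m - 1\<close>.\<close>
  obtain j where n: "n = t (k + 4) + j" and j: "c \<le> j" "j < c + t (k + 3)"
    using assms(3) unfolding m G(4)
    by (metis add.assoc add_le_cancel_left atLeastLessThan_iff le_add1 le_iff_add
        nat_add_left_cancel_less)
  have "j \<le> length (bisp (Suc (k + 3)))"
    using j length_bisp_Suc[of "k + 3"] by (simp add: c_def del: bisp.simps)
  from sum_a_shift[OF this]
  have sum_eq: "(\<Sum>i = t (k + 4) + c..n. a i) = (\<Sum>i = c..j. a i) + (Suc j - t (k + 4))"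
    by (simp add: n c_def eval_nat_numeral del: bisp.simps)
  have pos: "0 < t i" for i using t_gt[of i] by simp
  have t3: "t (k + 3) = t (k + 2) + t (k + 1) + t k" by (rule t_rec)
  have mins: "Min (Gamma1 (k + 5)) = t (k + 4) + c" "Min (Gamma3 (k + 4)) = c"
    "Min (Gamma2 (k + 4)) = c + t k" "Min (Gamma1 (k + 4)) = c + t k + t (k + 1)"
    unfolding G using pos t3 by (simp_all add: Min_atLeastLessThan_nat)
  \<comment> \<open>Splits off the complete sets to the left of the one that contains
    \<open>j\<close>.\<close>
  have split: "(\<Sum>i = u..j. a i) = sum a {u..<v} + (\<Sum>i = v..j. a i)" if "u \<le> v" "v \<le> j" for u v
    using that sum.atLeastLessThan_concat[of u v "Suc j" a]
    by (simp add: atLeastLessThanSuc_atLeastAtMost)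
  have eta: "eta3 (k + 5) = t (k + 4) + t (k + 4)" unfolding eta3_def m1 by simp
  \<comment> \<open>This is \<open>theta9 m \<le> eta3 m\<close>: the correction term vanishes in
    the first two cases, and in the last one \<open>j\<close> lies in
    \<open>Gamma1 (m - 1)\<close>.\<close>
  have c_less: "c + t k + t (k + 1) \<le> t (k + 4)"
  proof -
    have "2 * c + 1 = t (k + 4) + t (k + 2)"
      using length_bisp[of "k + 2"] by (simp add: c_def eval_nat_numeral del: bisp.simps)
    moreover have "t (k + 4) = t (k + 3) + t (k + 2) + t (k + 1)"
      using t_rec[of "k + 1"] by (simp add: eval_nat_numeral)
    moreover have "t k \<le> t (k + 2)" using strict_mono_t by (simp add: strict_mono_less_eq)
    ultimately show ?thesis using t3 by linarith
  qed
  have real_iffs: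
    "theta7 m \<le> real n \<and> real n < theta8 m \<longleftrightarrow> j < c + t k"
    "theta8 m \<le> real n \<and> real n < theta9 m \<longleftrightarrow> c + t k \<le> j \<and> j < c + t k + t (k + 1)"
    "theta9 m \<le> real n \<and> n < eta3 m \<longleftrightarrow> c + t k + t (k + 1) \<le> j \<and> j < t (k + 4)"
    "eta3 m \<le> n \<and> real n < theta10 m \<longleftrightarrow> t (k + 4) \<le> j"
    unfolding m n G eta of_nat_le_iff of_nat_less_iff using j by auto
  have nj: "n - t (k + 4) = j" "n - eta3 m = j - t (k + 4)" by (simp_all add: n m eta)
  show ?thesis
    unfolding real_iffs nj
    unfolding m m1 mins sum_eq nj
    unfolding G(1,2)
    using c_less split[of c "c + t k"] split[of "c + t k" "c + t k + t (k + 1)"]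
    by auto
qed

end
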